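(* Let $(G,\sigma)$ be a bridgeless signed graph with a fixed orientation $\tau$. If $(G,\sigma)$ admits a modulo $3$-flow $f_1$, then it also admits an integer-valued $4$-flow $f_2$ with $\mathrm{supp}(f_1)\subseteq\{e\in E(G)\colon f_2(e)\in\{\pm1,\pm2\}\}$.
   Context: Graphs may have multiple edges and loops; a bridge is an edge whose removal increases the number of components. A signed graph $(G,\sigma)$ is a graph $G$ with a signature $\sigma\colon E(G)\to\{\pm1\}$; an edge $e$ is positive if $\sigma(e)=1$ and negative otherwise. Each edge consists of two half-edges, each incident with exactly one end of the edge; $H(v)$ denotes the set of half-edges incident with $v$, $H(G)=\bigcup_v H(v)$, and $e_h$ is the edge containing half-edge $h$. An orientation of $(G,\sigma)$ is a map $\tau\colon H(G)\to\{\pm1\}$ with $\tau(h_1)\tau(h_2)=-\sigma(e)$ for every edge $e$ with half-edges $h_1,h_2$. For a positive integer $k$ and a map $f\colon E(G)\to\mathbb{Z}$ with $0\le |f(e)|\le k-1$ for all $e$, the boundary of $f$ at $v$ is $\partial f(v)=\sum_{h\in H(v)} f(e_h)\tau(h)$. Such $f$ is an integer-valued $k$-flow if $\partial f(v)=0$ for all $v$, and a modulo $k$-flow if $\partial f(v)\equiv 0\pmod k$ for all $v$. The support is $\mathrm{supp}(f)=\{e\colon f(e)\neq 0\}$. *)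

theory Defs
  imports "HOL-Number_Theory.Cong"
begin

text \<open>
  Graphs may have multiple edges and loops. An edge consists of two half-edges, and each half-edge
  is incident with one vertex; so a loop is an edge whose two half-edges are
  incident with the same vertex, and both of them lie in \<open>H(v)\<close>.
\<close>

record ('v, 'e, 'h) multigraph =
  verts :: "'v set"
  edges :: "'e set"
  halves :: "'h set"
  edge_of :: "'h \<Rightarrow> 'e"
  vert_of :: "'h \<Rightarrow> 'v"

locale finite_multigraph =
  fixes G :: "('v, 'e, 'h) multigraph"
  assumes finite_verts: "finite (verts G)"
    and finite_edges: "finite (edges G)"
    and vert_of_in: "h \<in> halves G \<Longrightarrow> vert_of G h \<in> verts G"
    and edge_of_in: "h \<in> halves G \<Longrightarrow> edge_of G h \<in> edges G"
    and two_halves: "e \<in> edges G \<Longrightarrow> card {h \<in> halves G. edge_of G h = e} = 2"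

definition halves_at :: "('v, 'e, 'h) multigraph \<Rightarrow> 'v \<Rightarrow> 'h set" where
  "halves_at G v = {h \<in> halves G. vert_of G h = v}"

definition adjacency :: "('v, 'e, 'h) multigraph \<Rightarrow> 'v rel" where
  "adjacency G = {(vert_of G h1, vert_of G h2) | h1 h2.
     h1 \<in> halves G \<and> h2 \<in> halves G \<and> h1 \<noteq> h2 \<and> edge_of G h1 = edge_of G h2}"

definition connected_rel :: "('v, 'e, 'h) multigraph \<Rightarrow> 'v rel" where
  "connected_rel G = (adjacency G)\<^sup>* \<inter> verts G \<times> verts G"

definition components :: "('v, 'e, 'h) multigraph \<Rightarrow> 'v set set" where
  "components G = verts G // connected_rel G"

lemma sym_adjacency: "sym (adjacency G)"
  unfolding adjacency_def sym_def by auto metis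

lemma equiv_connected_rel: "equiv (verts G) (connected_rel G)"
proof (rule equivI)
  show "connected_rel G \<subseteq> verts G \<times> verts G"
    by (auto simp: connected_rel_def)
  show "refl_on (verts G) (connected_rel G)"
    by (auto simp: connected_rel_def refl_on_def)
  show "sym (connected_rel G)"
    using sym_rtrancl[OF sym_adjacency[of G]] by (auto simp: connected_rel_def sym_def)
  show "trans (connected_rel G)"
    by (auto simp: connected_rel_def trans_def)
qed

definition delete_edge :: "('v, 'e, 'h) multigraph \<Rightarrow> 'e \<Rightarrow> ('v, 'e, 'h) multigraph" where
  "delete_edge G e =
     G\<lparr>edges := edges G - {e}, halves := {h \<in> halves G. edge_of G h \<noteq> e}\<rparr>"

definition bridge :: "('v, 'e, 'h) multigraph \<Rightarrow> 'e \<Rightarrow> bool" where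
  "bridge G e \<longleftrightarrow>
     e \<in> edges G \<and> card (components (delete_edge G e)) > card (components G)"

definition bridgeless :: "('v, 'e, 'h) multigraph \<Rightarrow> bool" where
  "bridgeless G \<longleftrightarrow> (\<forall>e. \<not> bridge G e)"

definition signature :: "('v, 'e, 'h) multigraph \<Rightarrow> ('e \<Rightarrow> int) \<Rightarrow> bool" where
  "signature G \<sigma> \<longleftrightarrow> (\<forall>e \<in> edges G. \<sigma> e \<in> {1, -1})"

definition orientation ::
  "('v, 'e, 'h) multigraph \<Rightarrow> ('e \<Rightarrow> int) \<Rightarrow> ('h \<Rightarrow> int) \<Rightarrow> bool" where
  "orientation G \<sigma> \<tau> \<longleftrightarrow>
     (\<forall>h \<in> halves G. \<tau> h \<in> {1, -1}) \<and>
     (\<forall>e \<in> edges G. \<forall>h1 \<in> halves G. \<forall>h2 \<in> halves G.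
        h1 \<noteq> h2 \<and> edge_of G h1 = e \<and> edge_of G h2 = e \<longrightarrow> \<tau> h1 * \<tau> h2 = - \<sigma> e)"

definition boundary ::
  "('v, 'e, 'h) multigraph \<Rightarrow> ('h \<Rightarrow> int) \<Rightarrow> ('e \<Rightarrow> int) \<Rightarrow> 'v \<Rightarrow> int" where
  "boundary G \<tau> f v = (\<Sum>h \<in> halves_at G v. f (edge_of G h) * \<tau> h)"

definition integer_flow ::
  "('v, 'e, 'h) multigraph \<Rightarrow> ('h \<Rightarrow> int) \<Rightarrow> nat \<Rightarrow> ('e \<Rightarrow> int) \<Rightarrow> bool" where
  "integer_flow G \<tau> k f \<longleftrightarrow>
     (\<forall>e \<in> edges G. \<bar>f e\<bar> \<le> int k - 1) \<and> (\<forall>v \<in> verts G. boundary G \<tau> f v = 0)"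

definition modulo_flow ::
  "('v, 'e, 'h) multigraph \<Rightarrow> ('h \<Rightarrow> int) \<Rightarrow> nat \<Rightarrow> ('e \<Rightarrow> int) \<Rightarrow> bool" where
  "modulo_flow G \<tau> k f \<longleftrightarrow>
     (\<forall>e \<in> edges G. \<bar>f e\<bar> \<le> int k - 1) \<and>
     (\<forall>v \<in> verts G. [boundary G \<tau> f v = 0] (mod int k))"

definition supp :: "('v, 'e, 'h) multigraph \<Rightarrow> ('e \<Rightarrow> int) \<Rightarrow> 'e set" where
  "supp G f = {e \<in> edges G. f e \<noteq> 0}"

end

theory Submission
  imports Defs Complex_Main
begin

text \<open>
  Orient the support of \<open>f1\<close> so that \<open>f1\<close> is \<open>1\<close> modulo 3 on it, and replace each edge outside the support
  by two oppositely oriented copies. If a set \<open>Y\<close> of the resulting edges has boundary exactly a third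
  of the total boundary, then giving the value \<open>-2\<close> to the edges in \<open>Y\<close> and \<open>1\<close> to the others is an
  integer flow; it is \<open>1\<close> or \<open>-2\<close> on the support, and \<open>0\<close> or \<open>\<plusminus>3\<close> on each edge outside it.

  Such a \<open>Y\<close> is a perfect matching restricted to \<open>E(G)\<close> in an auxiliary graph: a vertex at which the majority
  sign has \<open>3k\<close> more half-edges than the other is expanded into the complete bipartite graph between
  the majority half-edges and the other half-edges together with \<open>2k\<close> new vertices. Edges of \<open>G\<close> get
  weight \<open>1/3\<close>, and the gadgets are weighted so that every vertex has weight 1. An odd cut then has
  weight at least 1: otherwise it contains a single edge of \<open>G\<close> and separates no two half-edges at
  the same vertex, so that this edge is a bridge. Tutte's theorem yields the matching.
\<close>

section \<open>Hall's and Tutte's theorems\<close>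

text \<open>Induction on \<open>card I\<close>. If some nonempty proper \<open>J\<close> is tight,
  its union is reserved for it; the rest keeps the condition because \<open>K\<close> can be counted
  together with \<open>J\<close>. If none is tight, every nonempty proper subfamily has an element
  to spare, so any \<open>i\<close> may take any \<open>a\<close> from \<open>A i\<close>.\<close>

lemma hall_marriage:
  fixes A :: "'i \<Rightarrow> 'a set"
  assumes "finite I" and "\<forall>i\<in>I. finite (A i)" and "\<forall>J\<subseteq>I. card J \<le> card (\<Union>(A ` J))"
  shows "\<exists>f. inj_on f I \<and> (\<forall>i\<in>I. f i \<in> A i)"
  using assms
proof (induction "card I" arbitrary: I A rule: less_induct)
  case less
  have finU: "finite (\<Union>(A ` J))" if "J \<subseteq> I" for J
    using that less.prems finite_subset by fastforce
  show ?case
  proof (cases "I = {}")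
    case True
    then show ?thesis by auto
  next
    case False
    then obtain i where i: "i \<in> I" by auto
    show ?thesis
    proof (cases "\<exists>J\<subseteq>I. J \<noteq> {} \<and> J \<noteq> I \<and> card (\<Union>(A ` J)) = card J")
      case True
      then obtain J where J: "J \<subseteq> I" "J \<noteq> {}" "J \<noteq> I" "card (\<Union>(A ` J)) = card J"
        by auto
      let ?U = "\<Union>(A ` J)"
      have finJ: "finite J" using J less.prems by (meson finite_subset)
      have "card J < card I"
        using J less.prems by (meson psubsetI psubset_card_mono)
      then have "\<exists>f. inj_on f J \<and> (\<forall>i\<in>J. f i \<in> A i)"
        using less.prems J finJ by (intro less.hyps) auto
      then obtain f where f: "inj_on f J" "\<forall>i\<in>J. f i \<in> A i" by auto
      have "card (I - J) < card I"
        using J less.prems by (intro psubset_card_mono) auto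
      moreover have "\<forall>K\<subseteq>I - J. card K \<le> card (\<Union>((\<lambda>i. A i - ?U) ` K))"
      proof (intro allI impI)
        fix K assume K: "K \<subseteq> I - J"
        have finK: "finite K" using K less.prems finite_subset by blast
        have "card K + card J = card (K \<union> J)"
          using K finK finJ by (subst card_Un_disjoint) auto
        also have "\<dots> \<le> card (\<Union>(A ` (K \<union> J)))"
          using K J by (intro less.prems(3)[rule_format]) auto
        also have "\<Union>(A ` (K \<union> J)) = \<Union>((\<lambda>i. A i - ?U) ` K) \<union> ?U" by auto
        also have "card \<dots> \<le> card (\<Union>((\<lambda>i. A i - ?U) ` K)) + card ?U"
          by (rule card_Un_le)
        finally show "card K \<le> card (\<Union>((\<lambda>i. A i - ?U) ` K))" using J by simp
      qed
      ultimately have "\<exists>f. inj_on f (I - J) \<and> (\<forall>i\<in>I - J. f i \<in> A i - ?U)"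
        using less.prems by (intro less.hyps) auto
      then obtain g where g: "inj_on g (I - J)" "\<forall>i\<in>I - J. g i \<in> A i - ?U" by auto
      let ?h = "\<lambda>i. if i \<in> J then f i else g i"
      have "inj_on ?h I"
        using f g unfolding inj_on_def by (smt (verit, best) DiffD2 DiffI UN_I)
      moreover have "\<forall>i\<in>I. ?h i \<in> A i" using f g by auto
      ultimately show ?thesis by blast
    next
      case False
      have "card {i} \<le> card (\<Union>(A ` {i}))" using less.prems i by blast
      then have "A i \<noteq> {}" by auto
      then obtain a where a: "a \<in> A i" by auto
      have "card (I - {i}) < card I"
        using i less.prems by (intro psubset_card_mono) auto
      moreover have "\<forall>K\<subseteq>I - {i}. card K \<le> card (\<Union>((\<lambda>j. A j - {a}) ` K))"
      proof (intro allI impI)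
        fix K assume K: "K \<subseteq> I - {i}"
        show "card K \<le> card (\<Union>((\<lambda>j. A j - {a}) ` K))"
        proof (cases "K = {}")
          case False
          have "K \<subseteq> I" "K \<noteq> I" using K i by auto
          then have "card K \<noteq> card (\<Union>(A ` K))" "card K \<le> card (\<Union>(A ` K))"
            using False \<open>\<not> (\<exists>J\<subseteq>I. _ J)\<close> less.prems by metis+
          moreover have "\<Union>((\<lambda>j. A j - {a}) ` K) = \<Union>(A ` K) - {a}" by auto
          moreover have "card (\<Union>(A ` K)) - 1 \<le> card (\<Union>(A ` K) - {a})"
            using finU[OF \<open>K \<subseteq> I\<close>] by (simp add: card_Diff_singleton_if)
          ultimately show ?thesis by simp
        qed auto
      qed
      ultimately have "\<exists>f. inj_on f (I - {i}) \<and> (\<forall>j\<in>I - {i}. f j \<in> A j - {a})"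
        using less.prems by (intro less.hyps) auto
      then obtain f where f: "inj_on f (I - {i})" "\<forall>j\<in>I - {i}. f j \<in> A j - {a}" by auto
      have "inj_on (f(i := a)) I"
        using f unfolding inj_on_def by (smt (verit) DiffD2 DiffI fun_upd_apply singletonD singletonI)
      moreover have "\<forall>j\<in>I. (f(i := a)) j \<in> A j" using f a by auto
      ultimately show ?thesis by blast
    qed
  qed
qed

text \<open>
  The members of \<open>F\<close> are closed in \<open>V - S\<close> but need not be connected. Counting such families instead
  of odd components gives the same condition in Tutte's theorem without a notion of component.
\<close>
definition odd_family ::
  "('a \<Rightarrow> 'a \<Rightarrow> bool) \<Rightarrow> 'a set \<Rightarrow> 'a set \<Rightarrow> 'a set set \<Rightarrow> bool" where
  "odd_family E V S F \<longleftrightarrow> S \<subseteq> V \<and> pairwise disjnt F \<and>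
     (\<forall>C\<in>F. C \<subseteq> V - S \<and> odd (card C) \<and> (\<forall>x\<in>C. \<forall>y\<in>V - S - C. \<not> E x y))"

definition perfect_matching :: "('a \<Rightarrow> 'a \<Rightarrow> bool) \<Rightarrow> 'a set \<Rightarrow> ('a \<Rightarrow> 'a) \<Rightarrow> bool" where
  "perfect_matching E V m \<longleftrightarrow> (\<forall>x\<in>V. m x \<in> V \<and> m x \<noteq> x \<and> m (m x) = x \<and> E x (m x))"

section \<open>Parity of odd families, and Tutte's theorem\<close>

lemma odd_family_finite:
  assumes "finite V" "odd_family E V S F"
  shows "finite F" "finite (\<Union>F)" "\<And>C. C \<in> F \<Longrightarrow> finite C"
proof -
  have "F \<subseteq> Pow V" using assms by (auto simp: odd_family_def)
  then show "finite F" "finite (\<Union>F)" "\<And>C. C \<in> F \<Longrightarrow> finite C"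
    using assms(1) finite_subset by (auto intro: finite_subset[of _ "Pow V"] finite_subset[of _ V])
qed

lemma odd_family_parity:
  assumes "finite V" "odd_family E V S F"
  shows "even (card (\<Union>F)) \<longleftrightarrow> even (card F)"
proof -
  have "card (\<Union>F) = sum card F"
    using assms odd_family_finite[OF assms]
    by (intro card_Union_disjoint) (auto simp: odd_family_def)
  moreover have "{C \<in> F. odd (card C)} = F" using assms by (auto simp: odd_family_def)
  ultimately show ?thesis using odd_family_finite(1)[OF assms] by (simp add: even_sum_iff)
qed

text \<open>By symmetry of \<open>E\<close>, closedness of the members passes to what they leave
  uncovered, so the rest can itself become a member once its size is odd.\<close>

lemma odd_family_rest_closed:
  assumes "symp E" "odd_family E V S F" "x \<in> V - S - \<Union>F" "y \<in> V - S - (V - S - \<Union>F)"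
  shows "\<not> E x y"
proof -
  obtain C where "C \<in> F" "y \<in> C" using assms(4) by auto
  then show ?thesis using assms by (fastforce simp: odd_family_def dest: sympD)
qed

text \<open>Adding the uncovered rest when it is odd fixes the parity of the family. On a vertex set
  of even size a violation of Tutte's condition can then be taken to be at least 2.\<close>

lemma odd_family_extend:
  assumes "symp E" "finite V" "odd_family E V S F"
  obtains F' where "odd_family E V S F'" "card F \<le> card F'" "even (card F' + card S + card V)"
proof -
  let ?R = "V - S - \<Union>F"
  have sub: "S \<subseteq> V" "\<Union>F \<subseteq> V - S" using assms(3) by (auto simp: odd_family_def)
  have "V = S \<union> (\<Union>F \<union> ?R)" using sub by auto
  then have "card V = card S + card (\<Union>F \<union> ?R)"
    by (metis (no_types, lifting) Diff_partition assms(2) card_Un_disjoint Diff_disjoint finite_Diff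
        finite_subset sub)
  also have "card (\<Union>F \<union> ?R) = card (\<Union>F) + card ?R"
    using assms(2) odd_family_finite[OF assms(2,3)] by (intro card_Un_disjoint) auto
  finally have card: "card V = card S + (card (\<Union>F) + card ?R)" .
  show ?thesis
  proof (cases "even (card ?R)")
    case True
    then show ?thesis
      using that[OF assms(3)] card odd_family_parity[OF assms(2,3)] by auto
  next
    case False
    have "odd_family E V S (insert ?R F)"
      unfolding odd_family_def
    proof (intro conjI ballI)
      show "S \<subseteq> V" by fact
      show "pairwise disjnt (insert ?R F)"
        using assms(3) by (auto simp: odd_family_def pairwise_insert disjnt_def)
      fix C assume C: "C \<in> insert ?R F"
      show "C \<subseteq> V - S" using C sub by auto
      show "odd (card C)" using C False assms(3) by (auto simp: odd_family_def)
      fix x y assume "x \<in> C" "y \<in> V - S - C"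
      then show "\<not> E x y"
        using C odd_family_rest_closed[OF assms(1,3)] assms(3)
        by (cases "C = ?R") (auto simp: odd_family_def)
    qed
    moreover have "?R \<notin> F" 
    proof
      assume "?R \<in> F"
      then have "?R = {}" by auto
      then show False using False by (metis card.empty even_zero)
    qed
    ultimately show ?thesis
      using that[of "insert ?R F"] card False odd_family_parity[OF assms(2,3)]
        odd_family_finite(1)[OF assms(2,3)] by auto
  qed
qed

text \<open>
  Anderson's proof: for a maximal tight set \<open>S\<close>, every member of the family is factor-critical, and
  Hall's theorem matches the family with \<open>S\<close>.
\<close>
lemma tutte_perfect_matching:
  assumes "finite V" and "symp E" and "\<And>S F. odd_family E V S F \<Longrightarrow> card F \<le> card S"
  shows "\<exists>m. perfect_matching E V m"
  using assms(1,3)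
proof (induction "card V" arbitrary: V rule: less_induct)
  case less
  note fin = \<open>finite V\<close> and tutte = less.prems(2)
  have fam0: "odd_family E V {} {}" by (auto simp: odd_family_def)
  have even: "even (card V)"
  proof (rule ccontr)
    assume "odd (card V)"
    then have "odd_family E V {} {V}" by (auto simp: odd_family_def)
    from tutte[OF this] show False by simp
  qed
  \<comment> \<open>The empty set is tight and sizes are bounded by \<open>card V\<close>, so a
    largest tight \<open>S\<close> exists.\<close>
  have "\<exists>S. (\<exists>F. odd_family E V S F \<and> card F = card S) \<and>
      (\<forall>T. (\<exists>F. odd_family E V T F \<and> card F = card T) \<longrightarrow> card T \<le> card S)"
  proof (rule ex_has_greatest_nat[where P = "\<lambda>S. \<exists>F. odd_family E V S F \<and> card F = card S"])
    show "\<exists>F. odd_family E V {} F \<and> card F = card {}" using fam0 by auto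
    show "\<forall>T. (\<exists>F. odd_family E V T F \<and> card F = card T) \<longrightarrow> card T < Suc (card V)"
      using fin by (auto simp: odd_family_def less_Suc_eq_le intro: card_mono)
  qed
  then obtain S F where F: "odd_family E V S F" "card F = card S"
    and max: "\<And>T F'. odd_family E V T F' \<Longrightarrow> card F' = card T \<Longrightarrow> card T \<le> card S"
    by blast
  have finS: "finite S" using F fin finite_subset by (auto simp: odd_family_def)
  note finF = odd_family_finite[OF fin F(1)]
  have sub: "S \<subseteq> V" "\<And>C. C \<in> F \<Longrightarrow> C \<subseteq> V - S" using F(1) by (auto simp: odd_family_def)
  have oddC: "odd (card C)" if "C \<in> F" for C using F(1) that by (auto simp: odd_family_def)
  have disj: "C = D" if "C \<in> F" "D \<in> F" "x \<in> C" "x \<in> D" for C D x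
    using F(1) that by (auto simp: odd_family_def pairwise_def disjnt_def)
  have closed: "\<not> E x y" if "C \<in> F" "x \<in> C" "y \<in> V - S - C" for C x y
    using F(1) that by (auto simp: odd_family_def)
  \<comment> \<open>By parity the uncovered rest is even. If it were nonempty, moving one vertex
    \<open>r\<close> of it to \<open>S\<close> would leave an odd set that joins \<open>F\<close>,
    which gives a larger tight set.\<close>
  have cover: "V - S = \<Union>F"
  proof (rule ccontr)
    let ?R = "V - S - \<Union>F"
    assume "V - S \<noteq> \<Union>F"
    moreover have US: "\<Union>F \<subseteq> V - S" using sub(2) by (rule Sup_least)
    ultimately obtain r where r: "r \<in> ?R" by blast
    have "V - S = \<Union>F \<union> ?R" using US by auto
    then have "card V - card S = card (\<Union>F \<union> ?R)"
      using card_Diff_subset[OF finS sub(1)] by metis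
    also have "\<dots> = card (\<Union>F) + card ?R"
      using fin finF by (intro card_Un_disjoint) auto
    finally have "card V = card S + (card (\<Union>F) + card ?R)"
      using card_mono[OF fin sub(1)] by linarith
    then have "even (card ?R)" using even odd_family_parity[OF fin F(1)] F(2) by presburger
    moreover have "card ?R > 0" using r fin by (auto simp: card_gt_0_iff)
    ultimately have odd: "odd (card (?R - {r}))" using r fin by (auto simp: card_Diff_singleton)
    have "odd_family E V (insert r S) (insert (?R - {r}) F)"
      unfolding odd_family_def
    proof (intro conjI ballI)
      show "insert r S \<subseteq> V" using sub r by auto
      show "pairwise disjnt (insert (?R - {r}) F)"
        using F(1) by (auto simp: odd_family_def pairwise_insert disjnt_def)
      fix C assume C: "C \<in> insert (?R - {r}) F"
      show "C \<subseteq> V - insert r S" using C sub r by auto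
      show "odd (card C)" using C odd F(1) by (auto simp: odd_family_def)
      fix x y assume "x \<in> C" "y \<in> V - insert r S - C"
      then show "\<not> E x y"
        using C odd_family_rest_closed[OF assms(2) F(1)] closed r
        by (cases "C = ?R - {r}") auto
    qed
    moreover have "?R - {r} \<notin> F"
    proof
      assume "?R - {r} \<in> F"
      then have "?R - {r} = {}" by auto
      then show False using odd by (metis card.empty even_zero)
    qed
    then have "card (insert (?R - {r}) F) = card (insert r S)"
      using r finF(1) finS F(2) by auto
    ultimately have "card (insert r S) \<le> card S" by (rule max)
    then show False using r finS by auto
  qed
  have near: "\<exists>m. perfect_matching E (C - {c}) m" if C: "C \<in> F" and c: "c \<in> C" for C c
  proof (rule less.hyps)
    let ?W = "C - {c}"
    have finC: "finite C" and CV: "C \<subseteq> V - S" using C finF sub by auto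
    show "finite ?W" using finC by auto
    have "?W \<subset> V" using CV c by auto
    then show "card ?W < card V" using fin psubset_card_mono by blast
    have evenW: "even (card ?W)" using oddC[OF C] c finC by (auto simp: card_Diff_singleton)
    fix T H assume H0: "odd_family E ?W T H"
    show "card H \<le> card T"
    proof (rule ccontr)
      assume "\<not> card H \<le> card T"
      obtain H' where H: "odd_family E ?W T H'" "card H \<le> card H'"
        "even (card H' + card T + card ?W)"
        using odd_family_extend[OF assms(2) \<open>finite ?W\<close> H0] .
      \<comment> \<open>By parity the violation is at least 2, which pays for adding \<open>c\<close> to \<open>S\<close> and dropping \<open>C\<close>.\<close>
      then have ge: "card H' \<ge> card T + 2"
        using evenW \<open>\<not> card H \<le> card T\<close> by presburger
      have TW: "T \<subseteq> ?W" and HW: "\<And>D. D \<in> H' \<Longrightarrow> D \<subseteq> ?W - T"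
        using H(1) by (auto simp: odd_family_def)
      have oddH: "odd (card D)" if "D \<in> H'" for D using H(1) that by (auto simp: odd_family_def)
      have finT: "finite T" using TW \<open>finite ?W\<close> finite_subset by blast
      have finH: "finite H'" using odd_family_finite(1)[OF \<open>finite ?W\<close> H(1)] .
      let ?S = "insert c (S \<union> T)" and ?F = "(F - {C}) \<union> H'"
      have cardS: "card ?S = card S + card T + 1"
      proof -
        have "c \<notin> S \<union> T" "S \<inter> T = {}" using TW CV c by auto
        then show ?thesis using finS finT by (simp add: card_Un_disjoint)
      qed
      have "(F - {C}) \<inter> H' = {}"
      proof (rule ccontr)
        assume "(F - {C}) \<inter> H' \<noteq> {}"
        then obtain D where D: "D \<in> F" "D \<noteq> C" "D \<in> H'" by auto
        then obtain d where "d \<in> D" using oddH by fastforce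
        then show False using D HW disj[OF D(1) C] by auto
      qed
      then have "card ?F = (card F - 1) + card H'"
        using finF(1) finH C by (simp add: card_Un_disjoint card_Diff_singleton)
      moreover have "card F > 0" using C finF(1) by (auto simp: card_gt_0_iff)
      ultimately have cardF: "card ?F \<ge> card ?S" using ge cardS F(2) by linarith
      have fam: "odd_family E V ?S ?F"
        unfolding odd_family_def
      proof (intro conjI ballI)
        show "?S \<subseteq> V" using sub TW CV c by auto
        have "disjnt D D'" if "D \<in> F - {C}" "D' \<in> H'" for D D'
          using disj[of D C] HW[OF that(2)] that C by (auto simp: disjnt_def)
        then show "pairwise disjnt ?F"
          using F(1) H(1) unfolding odd_family_def pairwise_def
          by (metis DiffD1 Un_iff disjnt_sym)
        fix D assume D: "D \<in> ?F"
        \<comment> \<open>Members that meet \<open>C\<close> come from \<open>H'\<close>, the others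
          from \<open>F\<close>. For the former, edges inside \<open>C\<close> are excluded by
          \<open>H'\<close> and edges leaving \<open>C\<close> by the closedness of
          \<open>C\<close>.\<close>
        have DH: "D \<in> H'" if "D \<inter> C \<noteq> {}" using D that disj[of D C] C by auto
        have DF: "D \<in> F - {C}" if "D \<inter> C = {}"
        proof -
          have "D \<noteq> {}" if "D \<in> H'" using oddH[OF that] by force
          then show ?thesis using D that HW by blast
        qed
        show "D \<subseteq> V - ?S" 
        proof (cases "D \<inter> C = {}")
          case True
          then show ?thesis using DF sub TW c by blast
        next
          case False
          then show ?thesis using DH HW CV by blast
        qed
        show "odd (card D)" using D oddH oddC by auto
        fix x y assume x: "x \<in> D" and y: "y \<in> V - ?S - D"
        show "\<not> E x y"
        proof (cases "D \<inter> C = {}")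
          case True
          then show ?thesis using DF closed x y by blast
        next
          case False
          then have "D \<in> H'" using DH by auto
          show ?thesis
          proof (cases "y \<in> C")
            case True
            then show ?thesis using \<open>D \<in> H'\<close> H(1) x y by (auto simp: odd_family_def)
          next
            case False
            then show ?thesis using \<open>D \<in> H'\<close> HW closed[OF C, of x y] x y by blast
          qed
        qed
      qed
      \<comment> \<open>Tutte's condition allows no more than \<open>card ?S\<close> members, so
        \<open>?S\<close> is tight; but it is larger than \<open>S\<close>.\<close>
      from max[OF fam] tutte[OF fam] cardF cardS show False by linarith
    qed
  qed
  let ?N = "\<lambda>C. {s \<in> S. \<exists>x\<in>C. E x s}"
  have "\<exists>g. inj_on g F \<and> (\<forall>C\<in>F. g C \<in> ?N C)"
  proof (rule hall_marriage)
    show "\<forall>J\<subseteq>F. card J \<le> card (\<Union>(?N ` J))"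
    proof (intro allI impI)
      fix J assume J: "J \<subseteq> F"
      \<comment> \<open>Members of \<open>F\<close> have outside neighbours only in
        \<open>S\<close>. Once those neighbours are removed, \<open>J\<close> is an odd family, and
        Tutte's condition for it is Hall's.\<close>
      have "odd_family E V (\<Union>(?N ` J)) J"
        unfolding odd_family_def
      proof (intro conjI ballI)
        show "\<Union>(?N ` J) \<subseteq> V" using sub by auto
        show "pairwise disjnt J" using J F(1) pairwise_subset by (auto simp: odd_family_def)
        fix C assume C: "C \<in> J"
        show "C \<subseteq> V - \<Union>(?N ` J)" using C J sub by blast
        show "odd (card C)" using C J oddC by auto
        fix x y assume "x \<in> C" "y \<in> V - \<Union>(?N ` J) - C"
        then show "\<not> E x y" using closed[of C x y] C J by (cases "y \<in> S") auto
      qed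
      then show "card J \<le> card (\<Union>(?N ` J))" by (rule tutte)
    qed
  qed (use finF finS in auto)
  then obtain g where g: "inj_on g F" "\<And>C. C \<in> F \<Longrightarrow> g C \<in> ?N C" by auto
  have gF: "g ` F = S"
    using g F(2) finS by (intro card_seteq) (auto simp: card_image)
  from g(2) have "\<forall>C\<in>F. \<exists>x. x \<in> C \<and> E x (g C)" by auto
  then obtain c where c: "\<And>C. C \<in> F \<Longrightarrow> c C \<in> C \<and> E (c C) (g C)" by metis
  have "\<forall>C\<in>F. \<exists>m. perfect_matching E (C - {c C}) m" using near c by blast
  then obtain M where M: "\<And>C. C \<in> F \<Longrightarrow> perfect_matching E (C - {c C}) (M C)" by metis
  define cl where "cl x = (THE C. C \<in> F \<and> x \<in> C)" for x
  have cl: "cl x = C" if "C \<in> F" "x \<in> C" for x C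
    unfolding cl_def using that disj by (intro the_equality) auto
  \<comment> \<open>Each \<open>C\<close> sends one vertex \<open>c C\<close> to \<open>g C\<close>
    in \<open>S\<close> and matches the others internally by \<open>M C\<close>. Since
    \<open>g\<close> is a bijection from \<open>F\<close> to \<open>S\<close>, all of
    \<open>V\<close> is covered.\<close>
  define m where "m x = (if x \<in> S then c (inv_into F g x)
    else if x = c (cl x) then g (cl x) else M (cl x) x)" for x
  have mS: "m (g C) = c C" if "C \<in> F" for C
    using that gF g(1) by (auto simp: m_def)
  have mc: "m (c C) = g C" if "C \<in> F" for C
    using c[OF that] sub(2)[OF that] cl[OF that, of "c C"] by (auto simp: m_def)
  have mC: "m x = M C x" if "C \<in> F" "x \<in> C - {c C}" for C x
    using that sub(2)[OF that(1)] cl[OF that(1), of x] by (auto simp: m_def)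
  have "perfect_matching E V m"
    unfolding perfect_matching_def
  proof
    fix x assume x: "x \<in> V"
    consider (S) C where "C \<in> F" "x = g C" | (c) C where "C \<in> F" "x = c C"
      | (C) C where "C \<in> F" "x \<in> C - {c C}"
    proof (cases "x \<in> S")
      case False
      then obtain C where "C \<in> F" "x \<in> C" using x cover by blast
      then show ?thesis using that by (cases "x = c C") auto
    qed (use gF that in blast)
    then show "m x \<in> V \<and> m x \<noteq> x \<and> m (m x) = x \<and> E x (m x)"
    proof cases
      case S
      then show ?thesis
        using c[of C] g(2)[of C] mS[of C] mc[of C] sub(2)[of C] sympD[OF assms(2)] by auto
    next
      case c': c
      then show ?thesis
        using c[of C] g(2)[of C] mS[of C] mc[of C] sub(1) sub(2)[of C] by auto
    next
      case C
      then have "M C x \<in> C - {c C} \<and> M C x \<noteq> x \<and> M C (M C x) = x \<and> E x (M C x)"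
        using M[of C] by (auto simp: perfect_matching_def)
      then show ?thesis
        using mC[OF C(1), of x] mC[OF C(1), of "M C x"] C sub(2)[OF C(1)] by auto
    qed
  qed
  then show ?case by blast
qed

section \<open>The weighted gadget graph\<close>

text \<open>Double counting of the weight between \<open>F\<close> and \<open>S\<close>: every
  member of \<open>F\<close> sends at least 1, every vertex of \<open>S\<close> receives at most 1.
  This is Tutte's condition.\<close>

lemma fractional_perfect_matching:
  fixes w :: "'a \<Rightarrow> 'a \<Rightarrow> real"
  assumes "finite V" and sym: "\<And>x y. w x y = w y x" and nonneg: "\<And>x y. w x y \<ge> 0"
    and deg: "\<And>x. x \<in> V \<Longrightarrow> (\<Sum>y\<in>V. w x y) \<le> 1"
    and cut: "\<And>C. C \<subseteq> V \<Longrightarrow> odd (card C) \<Longrightarrow> (\<Sum>x\<in>C. \<Sum>y\<in>V - C. w x y) \<ge> 1"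
  shows "\<exists>m. perfect_matching (\<lambda>x y. w x y > 0) V m"
proof (rule tutte_perfect_matching)
  show "symp (\<lambda>x y. w x y > 0)" using sym by (auto simp: symp_def)
  fix S F assume F: "odd_family (\<lambda>x y. w x y > 0) V S F"
  note fin = odd_family_finite[OF \<open>finite V\<close> F]
  have sub: "S \<subseteq> V" "\<And>C. C \<in> F \<Longrightarrow> C \<subseteq> V - S" using F by (auto simp: odd_family_def)
  have finS: "finite S" using sub(1) \<open>finite V\<close> finite_subset by auto
  \<comment> \<open>Closedness of \<open>C\<close> means that its entire cut weight goes to
    \<open>S\<close>.\<close>
  have one: "1 \<le> (\<Sum>x\<in>C. \<Sum>y\<in>S. w x y)" if C: "C \<in> F" for C
  proof -
    have "w x y = 0" if "x \<in> C" "y \<in> V - C - S" for x y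
    proof -
      have "\<not> w x y > 0" using F C that by (auto simp: odd_family_def)
      then show ?thesis using nonneg[of x y] by linarith
    qed
    then have "(\<Sum>y\<in>S. w x y) = (\<Sum>y\<in>V - C. w x y)" if "x \<in> C" for x
      using that sub(1) sub(2)[OF C] \<open>finite V\<close> by (intro sum.mono_neutral_left) auto
    then have "(\<Sum>x\<in>C. \<Sum>y\<in>S. w x y) = (\<Sum>x\<in>C. \<Sum>y\<in>V - C. w x y)" by (rule sum.cong[OF refl])
    also have "\<dots> \<ge> 1" using F C by (intro cut) (auto simp: odd_family_def)
    finally show ?thesis .
  qed
  have "real (card F) = (\<Sum>C\<in>F. 1)" by simp
  also have "\<dots> \<le> (\<Sum>C\<in>F. \<Sum>x\<in>C. \<Sum>y\<in>S. w x y)" by (intro sum_mono one)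
  also have "\<dots> = (\<Sum>x\<in>\<Union>F. \<Sum>y\<in>S. w x y)"
    using F fin by (subst sum.Union_disjoint)
      (auto simp: odd_family_def pairwise_def disjnt_def)
  also have "\<dots> \<le> (\<Sum>x\<in>V. \<Sum>y\<in>S. w x y)"
    using sub(2) \<open>finite V\<close> by (intro sum_mono2) (auto intro: sum_nonneg nonneg)
  also have "\<dots> = (\<Sum>y\<in>S. \<Sum>x\<in>V. w y x)"
    by (subst sum.swap) (simp add: sym)
  also have "\<dots> \<le> (\<Sum>y\<in>S. 1)" using sub(1) by (intro sum_mono deg) auto
  finally show "card F \<le> card S" by simp
qed fact

lemma even_card_involution:
  assumes "finite T" and "\<And>x. x \<in> T \<Longrightarrow> p x \<in> T \<and> p x \<noteq> x \<and> p (p x) = x"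
  shows "even (card T)"
  using assms
proof (induction "card T" arbitrary: T rule: less_induct)
  case less
  show ?case
  proof (cases "T = {}")
    case False
    then obtain x where x: "x \<in> T" by auto
    let ?D = "{x, p x}"
    have D: "?D \<subseteq> T" "card ?D = 2" using less.prems(2)[OF x] x by (auto simp: card_insert_if)
    then have "card (T - ?D) = card T - 2" "card T \<ge> 2"
      using less.prems(1) card_mono[OF less.prems(1) D(1)] by (auto simp: card_Diff_subset)
    moreover have "even (card (T - ?D))"
    proof (rule less.hyps)
      fix y assume "y \<in> T - ?D"
      then show "p y \<in> T - ?D \<and> p y \<noteq> y \<and> p (p y) = y"
        using less.prems(2)[of y] less.prems(2)[OF x] by auto
    qed (use less.prems(1) calculation in auto)
    ultimately show ?thesis by presburger
  qed auto
qed

text \<open>The right side averages \<open>n - z\<close> and \<open>z\<close> with coefficients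
  \<open>c / a\<close> and \<open>(a - c) / a\<close>. It has the shape of the weight that one
  gadget contributes to a cut.\<close>

lemma convex_combination_ge:
  fixes a z n c :: real
  assumes "0 < a" "0 \<le> c" "c \<le> a" "t \<le> z" "t \<le> n - z"
  shows "t \<le> (c * (n - z) + (a - c) * z) / a"
proof -
  have "t * a = c * t + (a - c) * t" by (simp add: algebra_simps)
  also have "\<dots> \<le> c * (n - z) + (a - c) * z"
    using assms by (intro add_mono mult_left_mono) auto
  finally show ?thesis using assms(1) by (simp add: field_simps)
qed

text \<open>
  Tokens are half-edges of the graph in which edges outside the support are doubled; \<open>vt\<close> gives the
  end of a token, \<open>pr\<close> the other half of its edge, and \<open>maj\<close> whether it has the majority sign there.
\<close>
locale token_gadget =
  fixes X :: "'x set" and vt :: "'x \<Rightarrow> 'v" and pr :: "'x \<Rightarrow> 'x" and maj :: "'x \<Rightarrow> bool"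
    and k :: "'v \<Rightarrow> nat"
  assumes finX: "finite X"
    and pr: "x \<in> X \<Longrightarrow> pr x \<in> X \<and> pr x \<noteq> x \<and> pr (pr x) = x"
    and balance: "card {x \<in> X. vt x = v \<and> maj x} = card {x \<in> X. vt x = v \<and> \<not> maj x} + 3 * k v"
    and no_single_cut: "card {x \<in> X. vt x \<in> U \<and> vt (pr x) \<notin> U} \<noteq> 1"
begin

abbreviation A :: "'v \<Rightarrow> 'x set" where "A v \<equiv> {x \<in> X. vt x = v \<and> maj x}"
abbreviation B :: "'v \<Rightarrow> 'x set" where "B v \<equiv> {x \<in> X. vt x = v \<and> \<not> maj x}"

definition major :: "'v \<Rightarrow> ('x + 'v \<times> nat) set" where
  "major v = Inl ` A v"
text \<open>The number \<open>2 * k v\<close> makes both sides of the gadget balance: the minority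
  side needs \<open>2/3 * card (B v) + 2 * k v\<close>, which by \<open>balance\<close> is
  \<open>2/3 * card (A v)\<close>, the need of the majority side.\<close>

definition filler :: "'v \<Rightarrow> ('x + 'v \<times> nat) set" where
  "filler v = (\<lambda>i. Inr (v, i)) ` {..<2 * k v}"
definition minor :: "'v \<Rightarrow> ('x + 'v \<times> nat) set" where
  "minor v = Inl ` B v \<union> filler v"
definition gverts :: "('x + 'v \<times> nat) set" where
  "gverts = Inl ` X \<union> (\<Union>v\<in>vt ` X. filler v)"

text \<open>What is missing to total weight 1 after the \<open>1/3\<close> from the edge of \<open>G\<close>, which fillers lack.\<close>
definition need :: "'x + 'v \<times> nat \<Rightarrow> real" where
  "need u = (case u of Inl _ \<Rightarrow> 2/3 | Inr _ \<Rightarrow> 1)"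

definition pend :: "'x + 'v \<times> nat \<Rightarrow> 'x + 'v \<times> nat \<Rightarrow> real" where
  "pend u u' = (if \<exists>x\<in>X. u = Inl x \<and> u' = Inl (pr x) then 1/3 else 0)"
text \<open>Each minority vertex spreads its need evenly over the \<open>card (A v)\<close> majority
  vertices, and each of these thereby receives 2/3. The function is directed from majority to
  minority; \<open>weight\<close> symmetrises it.\<close>

definition gad :: "'x + 'v \<times> nat \<Rightarrow> 'x + 'v \<times> nat \<Rightarrow> real" where
  "gad u u' = (\<Sum>v\<in>vt ` X. of_bool (u \<in> major v) * (of_bool (u' \<in> minor v) * need u') / card (A v))"
definition weight :: "'x + 'v \<times> nat \<Rightarrow> 'x + 'v \<times> nat \<Rightarrow> real" where
  "weight u u' = pend u u' + (gad u u' + gad u' u)"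

text \<open>Together with \<open>\<beta>\<close> this reduces a cut to two additive quantities per
  vertex, in terms of which the weight of a gadget between two sets is bilinear.\<close>

definition \<alpha> :: "'v \<Rightarrow> ('x + 'v \<times> nat) set \<Rightarrow> real" where
  "\<alpha> v C = (\<Sum>u\<in>C. of_bool (u \<in> major v))"
definition \<beta> :: "'v \<Rightarrow> ('x + 'v \<times> nat) set \<Rightarrow> real" where
  "\<beta> v C = (\<Sum>u\<in>C. of_bool (u \<in> minor v) * need u)"

section \<open>Degrees and cuts of the weighted gadget graph\<close>

lemma need_nonneg: "need u \<ge> 0" by (auto simp: need_def split: sum.splits)

lemma finH: "finite gverts" by (auto simp: gverts_def filler_def finX)

lemma card_A_pos: "v \<in> vt ` X \<Longrightarrow> card (A v) > 0"
proof -
  assume "v \<in> vt ` X"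
  then obtain x where x: "x \<in> X" "vt x = v" by auto
  show ?thesis
  proof (cases "maj x")
    case False
    then have "card (B v) > 0" using x finX by (auto simp: card_gt_0_iff)
    then show ?thesis using balance[of v] by linarith
  qed (use x finX in \<open>auto simp: card_gt_0_iff\<close>)
qed

lemma gad_nonneg: "gad u u' \<ge> 0"
  by (auto simp: gad_def intro!: sum_nonneg divide_nonneg_nonneg need_nonneg)

lemma gad_sum:
  "(\<Sum>u\<in>C. \<Sum>u'\<in>D. gad u u') = (\<Sum>v\<in>vt ` X. \<alpha> v C * \<beta> v D / card (A v))"
proof -
  have "(\<Sum>u\<in>C. \<Sum>u'\<in>D. gad u u') = (\<Sum>u\<in>C. \<Sum>v\<in>vt ` X. \<Sum>u'\<in>D.
      of_bool (u \<in> major v) * (of_bool (u' \<in> minor v) * need u') / card (A v))"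
    unfolding gad_def by (intro sum.cong refl sum.swap)
  also have "\<dots> = (\<Sum>v\<in>vt ` X. \<Sum>u\<in>C. \<Sum>u'\<in>D.
      of_bool (u \<in> major v) * (of_bool (u' \<in> minor v) * need u') / card (A v))"
    by (rule sum.swap)
  also have "\<dots> = (\<Sum>v\<in>vt ` X. \<alpha> v C * \<beta> v D / card (A v))"
    unfolding \<alpha>_def \<beta>_def by (intro sum.cong refl) (simp add: sum_product sum_divide_distrib)
  finally show ?thesis .
qed

lemma major_minor_subset:
  "v \<in> vt ` X \<Longrightarrow> major v \<subseteq> gverts" "v \<in> vt ` X \<Longrightarrow> minor v \<subseteq> gverts"
  by (auto simp: major_def minor_def gverts_def)

lemma \<alpha>_card: "finite C \<Longrightarrow> \<alpha> v C = card (C \<inter> major v)"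
  unfolding \<alpha>_def by (simp add: Int_def of_bool_def sum.If_cases)

lemma \<beta>_alt: "finite C \<Longrightarrow> \<beta> v C = (\<Sum>u\<in>C \<inter> minor v. need u)"
  unfolding \<beta>_def by (simp add: sum.inter_restrict)

lemma \<alpha>_all: "v \<in> vt ` X \<Longrightarrow> \<alpha> v gverts = card (A v)"
proof -
  assume v: "v \<in> vt ` X"
  have "gverts \<inter> major v = Inl ` A v" using major_minor_subset(1)[OF v] by (auto simp: major_def)
  then show ?thesis by (simp add: \<alpha>_card finH card_image)
qed

lemma \<beta>_all: "v \<in> vt ` X \<Longrightarrow> \<beta> v gverts = 2 / 3 * card (A v)"
proof -
  assume v: "v \<in> vt ` X"
  have "gverts \<inter> minor v = Inl ` B v \<union> filler v"
    using major_minor_subset(2)[OF v] by (auto simp: minor_def)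
  then have "\<beta> v gverts = (\<Sum>u\<in>Inl ` B v \<union> filler v. need u)" by (simp add: \<beta>_alt finH)
  also have "\<dots> = (\<Sum>u\<in>Inl ` B v. need u) + (\<Sum>u\<in>filler v. need u)"
    using finX by (intro sum.union_disjoint) (auto simp: filler_def)
  also have "(\<Sum>u\<in>Inl ` B v. need u) = 2 / 3 * card (B v)"
    by (subst sum.reindex) (auto simp: need_def)
  also have "(\<Sum>u\<in>filler v. need u) = 2 * k v"
    unfolding filler_def by (subst sum.reindex) (auto simp: need_def inj_on_def)
  finally show ?thesis using balance[of v] by simp
qed

lemma \<alpha>_Diff: "C \<subseteq> gverts \<Longrightarrow> \<alpha> v (gverts - C) = \<alpha> v gverts - \<alpha> v C"
  unfolding \<alpha>_def by (rule sum_diff[OF finH])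

lemma \<beta>_Diff: "C \<subseteq> gverts \<Longrightarrow> \<beta> v (gverts - C) = \<beta> v gverts - \<beta> v C"
  unfolding \<beta>_def by (rule sum_diff[OF finH])

lemma \<alpha>_nonneg: "\<alpha> v C \<ge> 0" unfolding \<alpha>_def by (auto intro: sum_nonneg)

lemma \<beta>_nonneg: "\<beta> v C \<ge> 0"
  unfolding \<beta>_def by (auto intro!: sum_nonneg mult_nonneg_nonneg need_nonneg)

lemma \<beta>_ge: "finite C \<Longrightarrow> u \<in> C \<Longrightarrow> u \<in> minor v \<Longrightarrow> \<beta> v C \<ge> need u"
  unfolding \<beta>_def using member_le_sum[of u C "\<lambda>u. of_bool (u \<in> minor v) * need u"]
  by (auto simp: need_nonneg)

lemma weight_sym: "weight u u' = weight u' u"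
proof -
  have "(\<exists>x\<in>X. u = Inl x \<and> u' = Inl (pr x)) \<Longrightarrow> (\<exists>x\<in>X. u' = Inl x \<and> u = Inl (pr x))" for u u' :: "'x + 'v \<times> nat"
    using pr by metis
  then have "pend u u' = pend u' u" unfolding pend_def by metis
  then show ?thesis by (simp add: weight_def)
qed

lemma weight_nonneg: "weight u u' \<ge> 0"
  using gad_nonneg[of u u'] gad_nonneg[of u' u] by (simp add: weight_def pend_def)

text \<open>As a function on pairs, \<open>pend\<close> lives on the graph of \<open>pr\<close>, so
  the double sum collapses to a count of tokens.\<close>

lemma pend_sum:
  assumes "C \<subseteq> gverts" "D \<subseteq> gverts"
  shows "(\<Sum>u\<in>C. \<Sum>u'\<in>D. pend u u') = card {x \<in> X. Inl x \<in> C \<and> Inl (pr x) \<in> D} / 3"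
proof -
  have finC: "finite C" and finD: "finite D" using assms finH finite_subset by auto
  let ?K = "{x \<in> X. Inl x \<in> C \<and> Inl (pr x) \<in> D}"
  have "(\<Sum>u\<in>C. \<Sum>u'\<in>D. pend u u') = (\<Sum>p\<in>C \<times> D. pend (fst p) (snd p))"
    by (simp add: sum.cartesian_product case_prod_unfold)
  also have "\<dots> = (\<Sum>p\<in>(\<lambda>x. (Inl x, Inl (pr x))) ` ?K. pend (fst p) (snd p))"
    using finC finD by (intro sum.mono_neutral_right) (auto simp: pend_def)
  also have "\<dots> = (\<Sum>x\<in>?K. 1 / 3)"
    by (subst sum.reindex) (auto simp: inj_on_def pend_def intro!: sum.cong)
  finally show ?thesis by simp
qed

lemma weight_sum:
  assumes "C \<subseteq> gverts" "D \<subseteq> gverts"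
  shows "(\<Sum>u\<in>C. \<Sum>u'\<in>D. weight u u') = card {x \<in> X. Inl x \<in> C \<and> Inl (pr x) \<in> D} / 3
     + (\<Sum>v\<in>vt ` X. (\<alpha> v C * \<beta> v D + \<alpha> v D * \<beta> v C) / card (A v))"
proof -
  have "(\<Sum>u\<in>C. \<Sum>u'\<in>D. gad u' u) = (\<Sum>u'\<in>D. \<Sum>u\<in>C. gad u' u)" by (rule sum.swap)
  then show ?thesis
    using pend_sum[OF assms]
    by (simp add: weight_def sum.distrib gad_sum add_divide_distrib)
qed

lemma weight_degree:
  assumes "u \<in> gverts"
  shows "(\<Sum>u'\<in>gverts. weight u u') = 1"
proof -
  \<comment> \<open>A degree is the case \<open>C = {u}\<close> of \<open>weight_sum\<close>. A
    token gets 1/3 from its partner and 2/3 from its gadget; a filler gets everything from its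
    gadget.\<close>
  have "(\<Sum>u'\<in>gverts. weight u u') = (\<Sum>u\<in>{u}. \<Sum>u'\<in>gverts. weight u u')" by simp
  also have "\<dots> = card {x \<in> X. Inl x \<in> {u} \<and> Inl (pr x) \<in> gverts} / 3
     + (\<Sum>v\<in>vt ` X. (\<alpha> v {u} * \<beta> v gverts + \<alpha> v gverts * \<beta> v {u}) / card (A v))"
    using assms by (intro weight_sum) auto
  also have "(\<Sum>v\<in>vt ` X. (\<alpha> v {u} * \<beta> v gverts + \<alpha> v gverts * \<beta> v {u}) / card (A v))
      = (\<Sum>v\<in>vt ` X. of_bool (u \<in> major v) * (2 / 3) + of_bool (u \<in> minor v) * need u)"
  proof (intro sum.cong refl)
    fix v assume v: "v \<in> vt ` X"
    show "(\<alpha> v {u} * \<beta> v gverts + \<alpha> v gverts * \<beta> v {u}) / card (A v)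
       = of_bool (u \<in> major v) * (2 / 3) + of_bool (u \<in> minor v) * need u"
      using card_A_pos[OF v]
      by (simp add: \<alpha>_all[OF v] \<beta>_all[OF v] \<alpha>_def[of v "{u}"] \<beta>_def[of v "{u}"] add_divide_distrib)
  qed
  also have "card {x \<in> X. Inl x \<in> {u} \<and> Inl (pr x) \<in> gverts} / 3 + \<dots> = (1::real)"
  proof (cases u)
    case (Inl x)
    then have x: "x \<in> X" using assms by (auto simp: gverts_def filler_def)
    have "{y \<in> X. Inl y \<in> {u} \<and> Inl (pr y) \<in> gverts} = {x}"
      using Inl x pr by (auto simp: gverts_def)
    moreover have "of_bool (u \<in> major v) * (2 / 3) + of_bool (u \<in> minor v) * need u
        = (if v = vt x then 2 / 3 else (0::real))" for v
      using Inl x by (auto simp: major_def minor_def filler_def need_def)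
    moreover have "(\<Sum>v\<in>vt ` X. if v = vt x then 2 / 3 else 0) = (2 / 3 :: real)"
      using x finX by (simp add: sum.delta)
    ultimately show ?thesis by (simp only:) simp
  next
    case (Inr p)
    then obtain v i where p: "p = (v, i)" "v \<in> vt ` X" "i < 2 * k v"
      using assms by (auto simp: gverts_def filler_def)
    have "{y \<in> X. Inl y \<in> {u} \<and> Inl (pr y) \<in> gverts} = {}" using Inr by auto
    moreover have "of_bool (u \<in> major v') * (2 / 3) + of_bool (u \<in> minor v') * need u
        = (if v' = v then 1 else (0::real))" for v'
      using Inr p by (auto simp: major_def minor_def filler_def need_def)
    moreover have "(\<Sum>v'\<in>vt ` X. if v' = v then 1 else 0) = (1 :: real)"
      using p finX by (simp add: sum.delta)
    ultimately show ?thesis by (simp only:) simp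
  qed
  finally show ?thesis .
qed

text \<open>If both sides contain majority vertices, the numerator is at least the total need
  \<open>2/3 * card (A v)\<close>. If one side has none, its given token is a minority token, and
  its whole need of 2/3 crosses the cut.\<close>

lemma gadget_cut_ge:
  assumes C: "C \<subseteq> gverts" and x: "x \<in> X" "Inl x \<in> C" and y: "y \<in> X" "Inl y \<notin> C"
    and v: "vt x = v" "vt y = v"
  shows "2 / 3 \<le> (\<alpha> v C * \<beta> v (gverts - C) + \<alpha> v (gverts - C) * \<beta> v C) / card (A v)"
proof -
  have vX: "v \<in> vt ` X" using x v by auto
  note pos = card_A_pos[OF vX]
  have finC: "finite C" using C finH finite_subset by auto
  have yH: "Inl y \<in> gverts - C" using y by (auto simp: gverts_def)
  have D: "\<alpha> v (gverts - C) = card (A v) - \<alpha> v C"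
    by (simp add: \<alpha>_Diff[OF C] \<alpha>_all[OF vX])
  have bz: "\<beta> v C + \<beta> v (gverts - C) = 2 / 3 * card (A v)"
    by (simp add: \<beta>_Diff[OF C] \<beta>_all[OF vX])
  have int: "\<alpha> v C = card (C \<inter> major v)" "\<alpha> v (gverts - C) = card ((gverts - C) \<inter> major v)"
    using finC finH by (auto simp: \<alpha>_card)
  have "real c \<ge> 1 \<or> real c = 0" for c by (cases c) auto
  then have "(\<alpha> v C \<ge> 1 \<or> \<alpha> v C = 0) \<and> (\<alpha> v (gverts - C) \<ge> 1 \<or> \<alpha> v (gverts - C) = 0)"
    unfolding int by blast
  then consider "\<alpha> v C \<ge> 1" "\<alpha> v (gverts - C) \<ge> 1" | "\<alpha> v C = 0" | "\<alpha> v (gverts - C) = 0"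
    by blast
  then show ?thesis
  proof cases
    case 1
    have "2 / 3 * card (A v) = 1 * \<beta> v (gverts - C) + 1 * \<beta> v C" using bz by simp
    also have "\<dots> \<le> \<alpha> v C * \<beta> v (gverts - C) + \<alpha> v (gverts - C) * \<beta> v C"
      using 1 \<beta>_nonneg by (intro add_mono mult_right_mono) auto
    finally show ?thesis using pos by (simp add: field_simps)
  next
    case 2
    then have "C \<inter> major v = {}" using int(1) finC by simp
    then have "\<not> maj x" using x v by (auto simp: major_def)
    then have "need (Inl x) \<le> \<beta> v C" using finC x v by (intro \<beta>_ge) (auto simp: minor_def)
    then show ?thesis using 2 D pos by (simp add: need_def)
  next
    case 3
    then have "(gverts - C) \<inter> major v = {}" using int(2) finH by simp
    then have "\<not> maj y" using yH y v by (auto simp: major_def)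
    then have "need (Inl y) \<le> \<beta> v (gverts - C)"
      using finH yH y v by (intro \<beta>_ge) (auto simp: minor_def)
    then show ?thesis using 3 D pos by (simp add: need_def)
  qed
qed

text \<open>A cut that splits the fillers of some vertex has weight 1 already there. Otherwise
  fillers do not affect parity, so an odd number of edges between partners crosses: three of them
  weigh 1, and a single one forces a split gadget worth another 2/3.\<close>

lemma weight_odd_cut:
  assumes C: "C \<subseteq> gverts" and odd: "odd (card C)"
  shows "(\<Sum>u\<in>C. \<Sum>u'\<in>gverts - C. weight u u') \<ge> 1"
proof -
  let ?g = "\<lambda>v. (\<alpha> v C * \<beta> v (gverts - C) + \<alpha> v (gverts - C) * \<beta> v C) / card (A v)"
  let ?K = "{x \<in> X. Inl x \<in> C \<and> Inl (pr x) \<in> gverts - C}"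
  have eq: "(\<Sum>u\<in>C. \<Sum>u'\<in>gverts - C. weight u u') = card ?K / 3 + (\<Sum>v\<in>vt ` X. ?g v)"
    using C by (intro weight_sum) auto
  have finC: "finite C" using C finH finite_subset by auto
  have g_nonneg: "?g v \<ge> 0" for v
    by (auto intro!: divide_nonneg_nonneg add_nonneg_nonneg mult_nonneg_nonneg \<alpha>_nonneg \<beta>_nonneg)
  have g_le: "?g v \<le> (\<Sum>v\<in>vt ` X. ?g v)" if "v \<in> vt ` X" for v
    using that finX g_nonneg by (intro member_le_sum) auto
  show ?thesis
  proof (cases "\<exists>v\<in>vt ` X. filler v \<inter> C \<noteq> {} \<and> \<not> filler v \<subseteq> C")
    case True
    then obtain v p q where v: "v \<in> vt ` X" and p: "p \<in> filler v" "p \<in> C"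
      and q: "q \<in> filler v" "q \<notin> C" by auto
    have qH: "q \<in> gverts - C" using q v by (auto simp: gverts_def)
    have "need p = 1" "need q = 1" using p q by (auto simp: filler_def need_def)
    moreover have "need p \<le> \<beta> v C" using finC p by (intro \<beta>_ge) (auto simp: minor_def)
    moreover have "need q \<le> \<beta> v (gverts - C)"
      using finH q qH by (intro \<beta>_ge) (auto simp: minor_def)
    moreover have "\<alpha> v C \<le> card (A v)"
      using \<alpha>_nonneg[of v "gverts - C"] by (simp add: \<alpha>_Diff[OF C] \<alpha>_all[OF v])
    \<comment> \<open>With a filler on each side both needs are at least 1, hence so is their
      average with coefficients given by \<open>\<alpha>\<close>.\<close>
    ultimately have "1 \<le> ?g v"
      using convex_combination_ge[of "card (A v)" "\<alpha> v C" 1 "\<beta> v C" "\<beta> v gverts"] card_A_pos[OF v]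
      by (simp add: \<beta>_Diff[OF C] \<alpha>_Diff[OF C] \<alpha>_all[OF v] \<alpha>_nonneg)
    moreover have "0 \<le> card ?K / 3" by simp
    ultimately show ?thesis using g_le[OF v] eq by linarith
  next
    case False
    let ?T = "{x \<in> X. Inl x \<in> C}" and ?Q = "\<Union>v\<in>{v \<in> vt ` X. filler v \<subseteq> C}. filler v"
    have Ceq: "C = Inl ` ?T \<union> ?Q"
    proof
      show "C \<subseteq> Inl ` ?T \<union> ?Q"
      proof
        fix u assume u: "u \<in> C"
        then have "u \<in> gverts" using C by auto
        then show "u \<in> Inl ` ?T \<union> ?Q" using u False unfolding gverts_def by blast
      qed
    qed auto
    have "card ?Q = (\<Sum>v\<in>{v \<in> vt ` X. filler v \<subseteq> C}. card (filler v))"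
      using finX by (intro card_UN_disjoint) (auto simp: filler_def)
    moreover have "card (filler v) = 2 * k v" for v
      unfolding filler_def by (subst card_image) (auto simp: inj_on_def)
    ultimately have "even (card ?Q)" by (simp add: dvd_sum)
    moreover have "card C = card (Inl ` ?T :: ('x + 'v \<times> nat) set) + card ?Q"
      using finX by (subst Ceq, intro card_Un_disjoint) (auto simp: filler_def)
    ultimately have oddT: "odd (card ?T)" using odd by (simp add: card_image)
    have K: "?K \<subseteq> ?T" "?K = {x \<in> ?T. pr x \<notin> ?T}" using pr by (auto simp: gverts_def)
    \<comment> \<open>The tokens of \<open>C\<close> that do not cross are paired off by
      \<open>pr\<close>.\<close>
    have "even (card (?T - ?K))"
    proof (rule even_card_involution)
      fix x assume "x \<in> ?T - ?K"
      then have "x \<in> X" "Inl x \<in> C" "Inl (pr x) \<in> C" using pr by (auto simp: gverts_def)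
      then show "pr x \<in> ?T - ?K \<and> pr x \<noteq> x \<and> pr (pr x) = x" using pr[of x] by auto
    qed (use finX in auto)
    moreover have "card ?T = card ?K + card (?T - ?K)"
      using card_Diff_subset[OF _ K(1)] card_mono[OF _ K(1)] finX by simp
    ultimately have oddK: "odd (card ?K)" using oddT by simp
    show ?thesis
    proof (cases "card ?K = 1")
      case True
      have "\<exists>x\<in>X. \<exists>y\<in>X. vt x = vt y \<and> Inl x \<in> C \<and> Inl y \<notin> C"
      proof (rule ccontr)
        assume *: "\<not> ?thesis"
        have "vt x \<in> vt ` ?T \<longleftrightarrow> Inl x \<in> C" if "x \<in> X" for x using * that by auto
        then have "{x \<in> X. vt x \<in> vt ` ?T \<and> vt (pr x) \<notin> vt ` ?T} = ?K"
          using pr by (auto simp: gverts_def)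
        then show False using no_single_cut[of "vt ` ?T"] True by simp
      qed
      then obtain x y where "x \<in> X" "y \<in> X" "vt x = vt y" "Inl x \<in> C" "Inl y \<notin> C" by auto
      then have "2 / 3 \<le> ?g (vt y)" "vt y \<in> vt ` X" using gadget_cut_ge[OF C] by auto
      moreover have "real (card ?K) / 3 = 1 / 3" using True by simp
      ultimately show ?thesis using g_le[of "vt y"] eq by linarith
    next
      case False
      have "n \<ge> 3" if "odd n" "n \<noteq> 1" for n :: nat using that by presburger
      then have "card ?K \<ge> 3" using oddK False by blast
      then have "card ?K / 3 \<ge> 1" by simp
      moreover have "0 \<le> (\<Sum>v\<in>vt ` X. ?g v)" by (intro sum_nonneg g_nonneg)
      ultimately show ?thesis using eq by linarith
    qed
  qed
qed

section \<open>From a perfect matching to a balanced set of tokens\<close>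

lemma weight_posD:
  assumes "weight u u' > 0"
  shows "(\<exists>x\<in>X. u = Inl x \<and> u' = Inl (pr x)) \<or> (\<exists>v. u \<in> major v \<and> u' \<in> minor v)
    \<or> (\<exists>v. u \<in> minor v \<and> u' \<in> major v)"
proof (rule ccontr)
  assume *: "\<not> ?thesis"
  then have "pend u u' = 0" by (auto simp: pend_def)
  moreover have "gad u u' = 0" "gad u' u = 0"
  proof -
    have "of_bool (u \<in> major v) * (of_bool (u' \<in> minor v) * need u') = 0"
      "of_bool (u' \<in> major v) * (of_bool (u \<in> minor v) * need u) = 0" for v
      using * by (cases "u \<in> major v"; cases "u' \<in> major v"; simp; blast)+
    then show "gad u u' = 0" "gad u' u = 0" unfolding gad_def by (simp_all only: div_0 sum.neutral_const)
  qed
  ultimately show False using assms by (simp add: weight_def)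
qed

text \<open>Tokens not matched to their partners are matched inside their gadgets. A gadget is
  bipartite with its fillers on the minority side, so the remaining majority tokens exceed the
  remaining minority tokens by the number of fillers.\<close>

lemma exists_balanced:
  obtains Y where "Y \<subseteq> X" "\<And>x. x \<in> Y \<Longrightarrow> pr x \<in> Y"
    "\<And>v. card (A v - Y) = card (B v - Y) + 2 * k v"
proof -
  obtain m where m: "perfect_matching (\<lambda>u u'. weight u u' > 0) gverts m"
    using fractional_perfect_matching[of gverts weight] finH weight_sym weight_nonneg weight_degree
      weight_odd_cut by (metis order_refl)
  then have mm: "m (m u) = u" "weight u (m u) > 0" "m u \<in> gverts" if "u \<in> gverts" for u
    using that by (auto simp: perfect_matching_def)
  \<comment> \<open>A loop with halves of opposite type is a gadget pair as well; when matched, it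
    is counted in \<open>Y\<close>, which removes one token from each side.\<close>
  define Y where "Y = {x \<in> X. m (Inl x) = Inl (pr x)}"
  have InlH: "Inl x \<in> gverts" if "x \<in> X" for x using that by (auto simp: gverts_def)
  have Ypr: "pr x \<in> Y" if "x \<in> Y" for x
    using that mm(1)[OF InlH, of x] pr[of x] by (auto simp: Y_def)
  have mY: "x \<in> Y" if "x \<in> X" "m u = Inl x" "u = Inl y" "y \<in> Y" for x y u
    using that Ypr by (auto simp: Y_def)
  have "card (A v - Y) = card (B v - Y) + 2 * k v" for v
  proof (cases "v \<in> vt ` X")
    case True
    let ?L = "Inl ` (A v - Y)" and ?R = "Inl ` (B v - Y) \<union> filler v"
    have LR: "m u \<in> ?R" if uL: "u \<in> ?L" for u
    proof -
      obtain x where x: "u = Inl x" "x \<in> A v" "x \<notin> Y" using uL by auto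
      have uH: "u \<in> gverts" using x InlH by auto
      have "\<not> (\<exists>x\<in>X. u = Inl x \<and> m u = Inl (pr x))" using x by (auto simp: Y_def)
      moreover have "u \<notin> minor v'" for v' using x by (auto simp: minor_def filler_def)
      ultimately obtain v' where "u \<in> major v'" "m u \<in> minor v'"
        using weight_posD[OF mm(2)[OF uH]] by auto
      moreover from this have "v' = v" using x by (auto simp: major_def)
      moreover have "y \<notin> Y" if "m u = Inl y" for y
        using mY[of x "m u" y] mm(1)[OF uH] x that by auto
      ultimately show ?thesis by (auto simp: minor_def)
    qed
    have RL: "m u \<in> ?L" if uR: "u \<in> ?R" for u
    proof -
      have uH: "u \<in> gverts" using uR InlH True by (auto simp: gverts_def)
      have um: "u \<in> minor v" using uR by (auto simp: minor_def)
      have "\<not> (\<exists>x\<in>X. u = Inl x \<and> m u = Inl (pr x))"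
        using uR by (auto simp: Y_def filler_def)
      moreover have "u \<notin> major v'" for v' using uR by (auto simp: major_def filler_def)
      ultimately obtain v' where v': "u \<in> minor v'" "m u \<in> major v'"
        using weight_posD[OF mm(2)[OF uH]] by auto
      then have "v' = v" using um by (auto simp: minor_def filler_def)
      then obtain x where x: "m u = Inl x" "x \<in> A v" using v' by (auto simp: major_def)
      have "x \<notin> Y"
      proof
        assume "x \<in> Y"
        then have "u = Inl (pr x)" "pr x \<in> Y" 
          using mm(1)[OF uH] x Ypr by (auto simp: Y_def)
        then show False using uR by (auto simp: filler_def)
      qed
      then show ?thesis using x by auto
    qed
    have "?L \<subseteq> gverts" "?R \<subseteq> gverts" using InlH True by (auto simp: gverts_def)
    then have "m (m u) = u" if "u \<in> ?L \<or> u \<in> ?R" for u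
      using that mm(1) by (elim disjE; simp only: subset_iff)
    then have "bij_betw m ?L ?R"
      by (intro bij_betw_byWitness[of _ m] ballI image_subsetI LR RL) (simp_all only: simp_thms)
    then have "card (Inl ` (A v - Y) :: ('x + 'v \<times> nat) set) = card ?R" by (rule bij_betw_same_card)
    also have "\<dots> = card (Inl ` (B v - Y) :: ('x + 'v \<times> nat) set) + card (filler v)"
      using finX by (intro card_Un_disjoint) (auto simp: filler_def)
    also have "card (filler v) = 2 * k v"
      unfolding filler_def by (subst card_image) (auto simp: inj_on_def)
    finally show ?thesis by (simp add: card_image)
  next
    case False
    then have AB: "A v = {}" "B v = {}" by auto
    then have "k v = 0" using balance[of v] unfolding AB by simp
    then show ?thesis unfolding AB by simp
  qed
  then show ?thesis using that[of Y] Ypr by (auto simp: Y_def)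
qed

end

section \<open>From balanced sets to flows\<close>

text \<open>Outside \<open>Y\<close> the signed sum at \<open>v\<close> is two thirds of the total
  \<open>d v\<close>, so \<open>Y\<close> carries the other third, and the values 1 outside and -2
  on \<open>Y\<close> cancel.\<close>

lemma signed_third_balanced:
  fixes sg :: "'x \<Rightarrow> int" and vt :: "'x \<Rightarrow> 'v"
  assumes finX: "finite X" and pr: "\<And>x. x \<in> X \<Longrightarrow> pr x \<in> X \<and> pr x \<noteq> x \<and> pr (pr x) = x"
    and cut: "\<And>U. card {x \<in> X. vt x \<in> U \<and> vt (pr x) \<notin> U} \<noteq> 1"
    and sg: "\<And>x. x \<in> X \<Longrightarrow> sg x = 1 \<or> sg x = -1"
    and div: "\<And>v. 3 dvd (\<Sum>x | x \<in> X \<and> vt x = v. sg x)"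
  obtains Y where "Y \<subseteq> X" "\<And>x. x \<in> Y \<Longrightarrow> pr x \<in> Y"
    "\<And>v. (\<Sum>x | x \<in> X \<and> vt x = v. sg x * (1 - 3 * of_bool (x \<in> Y))) = 0"
proof -
  define d where "d v = (\<Sum>x | x \<in> X \<and> vt x = v. sg x)" for v
  \<comment> \<open>When \<open>d v = 0\<close> neither sign prevails; either choice is consistent
    with \<open>k v = 0\<close>.\<close>
  define s :: "'v \<Rightarrow> int" where "s v = (if d v \<ge> 0 then 1 else -1)" for v
  define maj where "maj x \<longleftrightarrow> sg x = s (vt x)" for x
  define k where "k v = nat \<bar>d v\<bar> div 3" for v
  have s: "s v = 1 \<or> s v = -1" for v by (auto simp: s_def)
  have dk: "d v = s v * (3 * int (k v))" for v
  proof -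
    obtain c where "d v = 3 * c" using div[of v] by (auto simp: d_def)
    then show ?thesis by (auto simp: s_def k_def nat_mult_distrib abs_mult)
  qed
  have sum_sg: "(\<Sum>x | x \<in> X \<and> vt x = v \<and> P x. sg x)
      = s v * (int (card {x \<in> X. vt x = v \<and> maj x \<and> P x}) - int (card {x \<in> X. vt x = v \<and> \<not> maj x \<and> P x}))" for v P
  proof -
    let ?M = "{x \<in> X. vt x = v \<and> maj x \<and> P x}" and ?N = "{x \<in> X. vt x = v \<and> \<not> maj x \<and> P x}"
    have "{x. x \<in> X \<and> vt x = v \<and> P x} = ?M \<union> ?N" by auto
    then have "(\<Sum>x | x \<in> X \<and> vt x = v \<and> P x. sg x) = (\<Sum>x\<in>?M. sg x) + (\<Sum>x\<in>?N. sg x)"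
      using finX by (simp only:, intro sum.union_disjoint) auto
    moreover have "(\<Sum>x\<in>?M. sg x) = (\<Sum>x\<in>?M. s v)" by (intro sum.cong) (auto simp: maj_def)
    moreover have "(\<Sum>x\<in>?N. sg x) = (\<Sum>x\<in>?N. - s v)"
    proof (intro sum.cong refl)
      fix x assume "x \<in> ?N"
      then show "sg x = - s v" using sg[of x] s[of v] by (auto simp: maj_def)
    qed
    ultimately show ?thesis by (simp add: algebra_simps)
  qed
  interpret token_gadget X vt pr maj k
  proof
    fix v
    have "s v * (3 * int (k v)) = s v * (int (card {x \<in> X. vt x = v \<and> maj x}) - int (card {x \<in> X. vt x = v \<and> \<not> maj x}))"
      by (rule trans[OF dk[unfolded d_def, symmetric] sum_sg[of v "\<lambda>_. True", unfolded simp_thms]])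
    then show "card {x \<in> X. vt x = v \<and> maj x} = card {x \<in> X. vt x = v \<and> \<not> maj x} + 3 * k v"
      using s[of v] by auto
  qed (use finX pr cut in auto)
  obtain Y where Y: "Y \<subseteq> X" "\<And>x. x \<in> Y \<Longrightarrow> pr x \<in> Y"
    and bal: "\<And>v. card (A v - Y) = card (B v - Y) + 2 * k v"
    using exists_balanced by blast
  have "(\<Sum>x | x \<in> X \<and> vt x = v. sg x * (1 - 3 * of_bool (x \<in> Y))) = 0" for v
  proof -
    have "A v - Y = {x \<in> X. vt x = v \<and> maj x \<and> x \<notin> Y}" "B v - Y = {x \<in> X. vt x = v \<and> \<not> maj x \<and> x \<notin> Y}"
      by auto
    then have out: "(\<Sum>x | x \<in> X \<and> vt x = v \<and> x \<notin> Y. sg x) = s v * (2 * int (k v))"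
      using bal[of v] sum_sg[of v "\<lambda>x. x \<notin> Y"] by simp
    \<comment> \<open>The coefficient is rewritten as 3 times the indicator of the complement of
      \<open>Y\<close>, minus 2, so that \<open>out\<close> applies.\<close>
    have "(\<Sum>x | x \<in> X \<and> vt x = v. sg x * (1 - 3 * of_bool (x \<in> Y)))
        = (\<Sum>x | x \<in> X \<and> vt x = v. 3 * (if x \<notin> Y then sg x else 0) - 2 * sg x)"
      by (intro sum.cong) auto
    also have "\<dots> = 3 * (\<Sum>x | x \<in> X \<and> vt x = v. if x \<notin> Y then sg x else 0) - 2 * d v"
      by (simp add: sum_subtractf sum_distrib_left d_def)
    also have "(\<Sum>x | x \<in> X \<and> vt x = v. if x \<notin> Y then sg x else 0)
        = (\<Sum>x | x \<in> X \<and> vt x = v \<and> x \<notin> Y. sg x)"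
      using finX by (subst sum.inter_filter[symmetric]) (auto intro: sum.cong)
    finally show ?thesis using out dk[of v] by simp
  qed
  then show ?thesis using that Y by blast
qed

section \<open>Opposite halves, bridges and doubled edges in a multigraph\<close>

context finite_multigraph
begin

lemma finite_halves: "finite (halves G)"
proof -
  have "finite {h \<in> halves G. edge_of G h = e}" if "e \<in> edges G" for e
    by (rule card_ge_0_finite) (simp add: two_halves[OF that])
  then have "finite (\<Union>e\<in>edges G. {h \<in> halves G. edge_of G h = e})"
    by (intro finite_UN_I finite_edges)
  moreover have "halves G \<subseteq> (\<Union>e\<in>edges G. {h \<in> halves G. edge_of G h = e})"
    using edge_of_in by blast
  ultimately show ?thesis by (rule rev_finite_subset)
qed

definition opp :: "'h \<Rightarrow> 'h" where
  "opp h = (THE h'. h' \<in> halves G \<and> h' \<noteq> h \<and> edge_of G h' = edge_of G h)"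

lemma opp_unique:
  assumes "h \<in> halves G"
  shows "\<exists>!h'. h' \<in> halves G \<and> h' \<noteq> h \<and> edge_of G h' = edge_of G h"
proof -
  obtain a b where "{h' \<in> halves G. edge_of G h' = edge_of G h} = {a, b}" "a \<noteq> b"
    using two_halves[OF edge_of_in[OF assms]] by (auto simp: card_2_iff)
  then have "\<And>h'. h' \<in> halves G \<and> edge_of G h' = edge_of G h \<longleftrightarrow> h' = a \<or> h' = b" by blast
  then show ?thesis using assms \<open>a \<noteq> b\<close> by metis
qed

lemma opp:
  assumes "h \<in> halves G"
  shows "opp h \<in> halves G" "opp h \<noteq> h" "edge_of G (opp h) = edge_of G h"
  using theI'[OF opp_unique[OF assms]] unfolding opp_def by auto

lemma opp_eqI:
  assumes "h \<in> halves G" "h' \<in> halves G" "h' \<noteq> h" "edge_of G h' = edge_of G h"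
  shows "h' = opp h"
  using opp_unique[OF assms(1)] opp[OF assms(1)] assms by blast

lemma opp_opp: "h \<in> halves G \<Longrightarrow> opp (opp h) = h"
  using opp_eqI[of "opp h" h] opp[of h] by auto

text \<open>Without this edge nothing connects \<open>U\<close> to its complement, so the ends lie
  in different components. Components then map onto those of \<open>G\<close> surjectively but not
  injectively, and finiteness makes the count strictly larger.\<close>

lemma bridge_if_single_crossing:
  assumes h: "h \<in> halves G" "vert_of G h \<in> U" "vert_of G (opp h) \<notin> U"
    and single: "\<And>h'. h' \<in> halves G \<Longrightarrow> vert_of G h' \<in> U \<Longrightarrow> vert_of G (opp h') \<notin> U \<Longrightarrow> h' = h"
  shows "bridge G (edge_of G h)"
proof -
  let ?D = "delete_edge G (edge_of G h)"
  let ?a = "vert_of G h" and ?b = "vert_of G (opp h)"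
  let ?R = "connected_rel G" and ?Q = "connected_rel ?D"
  have vertsD: "verts ?D = verts G" by (simp add: delete_edge_def)
  have ab: "?a \<in> verts G" "?b \<in> verts G" using h(1) opp(1) vert_of_in by auto
  have "adjacency ?D \<subseteq> adjacency G" unfolding adjacency_def delete_edge_def by auto
  then have QR: "?Q \<subseteq> ?R" using rtrancl_mono vertsD unfolding connected_rel_def by blast
  note eqR = equiv_connected_rel[of G] and eqQ = equiv_connected_rel[of ?D, unfolded vertsD]
  have "(?a, ?b) \<in> adjacency G" using h(1) opp[OF h(1)] unfolding adjacency_def by force
  then have R: "(?a, ?b) \<in> ?R" using ab unfolding connected_rel_def by auto
  have step: "x \<in> U \<longleftrightarrow> y \<in> U" if "(x, y) \<in> adjacency ?D" for x y
  proof -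
    obtain h1 h2 where h12: "x = vert_of G h1" "y = vert_of G h2" "h1 \<in> halves G" "h2 \<in> halves G"
      "h1 \<noteq> h2" "edge_of G h1 = edge_of G h2" "edge_of G h1 \<noteq> edge_of G h"
      using \<open>(x, y) \<in> adjacency ?D\<close> unfolding adjacency_def delete_edge_def by auto
    then have opp12: "opp h1 = h2" "opp h2 = h1"
      using opp_eqI[of h1 h2] opp_eqI[of h2 h1] by auto
    have "h1 \<noteq> h" "h2 \<noteq> h" using h12 by auto
    then show ?thesis using single[of h1] single[of h2] h12(1-4) by (auto simp: opp12)
  qed
  have "x \<in> U \<longleftrightarrow> y \<in> U" if "(x, y) \<in> (adjacency ?D)\<^sup>*" for x y
    using that by (induction rule: rtrancl_induct) (use step in auto)
  then have Q: "(?a, ?b) \<notin> ?Q" using h unfolding connected_rel_def by auto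
  \<comment> \<open>Sends a component of the graph without the edge to the component of \<open>G\<close> containing it.\<close>
  let ?\<phi> = "\<lambda>C. ?R `` C"
  have \<phi>: "?R `` (?Q `` {x}) = ?R `` {x}" if x: "x \<in> verts G" for x
  proof
    show "?R `` (?Q `` {x}) \<subseteq> ?R `` {x}"
      using QR eqR by (auto simp: equiv_def dest: transD)
    show "?R `` {x} \<subseteq> ?R `` (?Q `` {x})"
      using x eqQ by (auto simp: equiv_def dest: refl_onD)
  qed
  have compD: "components ?D = (\<lambda>x. ?Q `` {x}) ` verts G"
    and compG: "components G = (\<lambda>x. ?R `` {x}) ` verts G"
    unfolding components_def quotient_def vertsD by blast+
  have image: "?\<phi> ` components ?D = components G"
    unfolding compD compG image_image by (rule image_cong[OF refl \<phi>])
  have finD: "finite (components ?D)" unfolding compD using finite_verts by simp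
  have "\<not> inj_on ?\<phi> (components ?D)"
  proof
    assume inj: "inj_on ?\<phi> (components ?D)"
    have "?R `` (?Q `` {?a}) = ?R `` (?Q `` {?b})"
      unfolding \<phi>[OF ab(1)] \<phi>[OF ab(2)] by (rule equiv_class_eq[OF eqR R])
    moreover have "?Q `` {?a} \<in> components ?D" "?Q `` {?b} \<in> components ?D"
      unfolding compD using ab by blast+
    ultimately have "?Q `` {?a} = ?Q `` {?b}" by (rule inj_onD[OF inj])
    then show False using Q eq_equiv_class[OF _ eqQ ab(2)] by blast
  qed
  then have "card (components G) \<noteq> card (components ?D)"
    using eq_card_imp_inj_on[OF finD, of ?\<phi>] unfolding image by blast
  then have "card (components G) < card (components ?D)"
    using card_image_le[OF finD, of ?\<phi>] unfolding image by simp
  then show ?thesis using edge_of_in[OF h(1)] by (simp add: bridge_def)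
qed

lemma finite_halves_at: "finite (halves_at G v)"
  using finite_halves by (simp add: halves_at_def)

text \<open>Translates sums over the doubled graph into sums over half-edges of \<open>G\<close>;
  \<open>Q\<close> marks the half-edges that have a second copy.\<close>

lemma token_sum:
  fixes g :: "'h \<times> bool \<Rightarrow> int"
  shows "(\<Sum>x | x \<in> {(h, b). h \<in> halves G \<and> (b \<or> Q h)} \<and> vert_of G (fst x) = v. g x)
    = (\<Sum>h\<in>halves_at G v. g (h, True) + (if Q h then g (h, False) else 0))"
proof -
  let ?T = "(\<lambda>h. (h, True)) ` halves_at G v" and ?F = "(\<lambda>h. (h, False)) ` {h \<in> halves_at G v. Q h}"
  have "{x. x \<in> {(h, b). h \<in> halves G \<and> (b \<or> Q h)} \<and> vert_of G (fst x) = v} = ?T \<union> ?F"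
    by (auto simp: halves_at_def image_iff)
  then have "(\<Sum>x | x \<in> {(h, b). h \<in> halves G \<and> (b \<or> Q h)} \<and> vert_of G (fst x) = v. g x)
      = (\<Sum>x\<in>?T. g x) + (\<Sum>x\<in>?F. g x)"
    using finite_halves_at by (simp only:, intro sum.union_disjoint) auto
  also have "(\<Sum>x\<in>?T. g x) = (\<Sum>h\<in>halves_at G v. g (h, True))"
    by (subst sum.reindex) (auto simp: inj_on_def)
  also have "(\<Sum>x\<in>?F. g x) = (\<Sum>h\<in>halves_at G v. if Q h then g (h, False) else 0)"
    using finite_halves_at
    by (subst sum.reindex) (auto simp: inj_on_def sum.inter_filter[symmetric])
  finally show ?thesis by (simp add: sum.distrib)
qed

end

theorem theorem1p5:
  fixes G :: "('v, 'e, 'h) multigraph"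
    and \<sigma> :: "'e \<Rightarrow> int"
    and \<tau> :: "'h \<Rightarrow> int"
    and f1 :: "'e \<Rightarrow> int"
  assumes "finite_multigraph G"
    and "bridgeless G"
    and "signature G \<sigma>"
    and "orientation G \<sigma> \<tau>"
    and "modulo_flow G \<tau> 3 f1"
  shows "\<exists>f2. integer_flow G \<tau> 4 f2 \<and>
           supp G f1 \<subseteq> {e \<in> edges G. f2 e \<in> {1, -1, 2, -2}}"
proof -
  interpret finite_multigraph G by fact
  \<comment> \<open>On the support \<open>r\<close> is the sign congruent to \<open>f1\<close>
    modulo 3. The value 1 elsewhere is a convention that the definition of \<open>f2\<close> relies
    on.\<close>
  define r :: "'e \<Rightarrow> int" where "r e = (if f1 e \<in> {-1, 2} then -1 else 1)" for e
  have r: "r e = 1 \<or> r e = -1" for e by (auto simp: r_def)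
  have \<tau>: "\<tau> h = 1 \<or> \<tau> h = -1" if "h \<in> halves G" for h
    using assms(4) that by (auto simp: orientation_def)
  let ?Z = "\<lambda>h. f1 (edge_of G h) = 0"
  \<comment> \<open>The copy \<open>(h, False)\<close> exists only outside the support and has the opposite sign.\<close>
  define X where "X = {(h, b). h \<in> halves G \<and> (b \<or> ?Z h)}"
  define pr :: "'h \<times> bool \<Rightarrow> 'h \<times> bool" where "pr x = (opp (fst x), snd x)" for x
  define sg :: "'h \<times> bool \<Rightarrow> int" where
    "sg x = (if snd x then 1 else -1) * r (edge_of G (fst x)) * \<tau> (fst x)" for x
  let ?vt = "\<lambda>x. vert_of G (fst x)"
  have tsum: "(\<Sum>x | x \<in> X \<and> ?vt x = v. g x)
      = (\<Sum>h\<in>halves_at G v. g (h, True) + (if ?Z h then g (h, False) else 0))"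
    for v and g :: "'h \<times> bool \<Rightarrow> int"
    unfolding X_def by (rule token_sum)
  have finX: "finite X"
  proof (rule finite_subset)
    show "X \<subseteq> halves G \<times> UNIV" by (auto simp: X_def)
  qed (simp add: finite_halves)
  have pr: "pr x \<in> X \<and> pr x \<noteq> x \<and> pr (pr x) = x" if "x \<in> X" for x
    using that opp[of "fst x"] opp_opp[of "fst x"] by (auto simp: X_def pr_def)
  have cut: "card {x \<in> X. ?vt x \<in> U \<and> ?vt (pr x) \<notin> U} \<noteq> 1" for U
  proof
    assume "card {x \<in> X. ?vt x \<in> U \<and> ?vt (pr x) \<notin> U} = 1"
    then obtain x where x: "{x \<in> X. ?vt x \<in> U \<and> ?vt (pr x) \<notin> U} = {x}"
      by (auto simp: card_1_singleton_iff)
    then have "x \<in> X" "?vt x \<in> U" "?vt (pr x) \<notin> U" by blast+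
    then have "fst x \<in> halves G" "?vt x \<in> U" "vert_of G (opp (fst x)) \<notin> U"
      by (auto simp: X_def pr_def)
    \<comment> \<open>Every half-edge has a copy marked \<open>True\<close>, so a unique crossing
      token means a unique crossing half-edge, and its edge is a bridge.\<close>
    moreover have "h' = fst x" if "h' \<in> halves G" "vert_of G h' \<in> U" "vert_of G (opp h') \<notin> U" for h'
    proof -
      have "(h', True) \<in> {x \<in> X. ?vt x \<in> U \<and> ?vt (pr x) \<notin> U}"
        using that by (auto simp: X_def pr_def)
      then have "(h', True) = x" unfolding x by (rule singletonD)
      then show ?thesis by auto
    qed
    ultimately have "bridge G (edge_of G (fst x))" by (rule bridge_if_single_crossing)
    then show False using assms(2) by (simp add: bridgeless_def)
  qed
  have sg: "sg x = 1 \<or> sg x = -1" if "x \<in> X" for x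
    using that r[of "edge_of G (fst x)"] \<tau>[of "fst x"] by (auto simp: X_def sg_def)
  have div: "3 dvd (\<Sum>x | x \<in> X \<and> ?vt x = v. sg x)" for v
  proof -
    have "3 dvd boundary G \<tau> f1 v"
    proof (cases "v \<in> verts G")
      case True
      then show ?thesis using assms(5) by (simp add: modulo_flow_def cong_0_iff)
    next
      case False
      then have "halves_at G v = {}" using vert_of_in by (auto simp: halves_at_def)
      then show ?thesis by (simp add: boundary_def)
    qed
    \<comment> \<open>Termwise: on the support \<open>f1\<close> and \<open>r\<close> differ by 0 or
      3 in absolute value; off it the two copies cancel.\<close>
    moreover have "3 dvd (\<Sum>h\<in>halves_at G v.
        f1 (edge_of G h) * \<tau> h - (sg (h, True) + (if ?Z h then sg (h, False) else 0)))"
    proof (rule dvd_sum)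
      fix h assume "h \<in> halves_at G v"
      then have "edge_of G h \<in> edges G" using edge_of_in by (auto simp: halves_at_def)
      then have "\<bar>f1 (edge_of G h)\<bar> \<le> 2" using assms(5) by (auto simp: modulo_flow_def)
      then have "f1 (edge_of G h) \<in> {-2, -1, 0, 1, 2}" by auto
      then show "3 dvd f1 (edge_of G h) * \<tau> h - (sg (h, True) + (if ?Z h then sg (h, False) else 0))"
        by (auto simp: sg_def r_def)
    qed
    ultimately show ?thesis
      unfolding tsum boundary_def sum_subtractf by (simp add: dvd_diff_right_iff)
  qed
  obtain Y where Y: "Y \<subseteq> X" "\<And>x. x \<in> Y \<Longrightarrow> pr x \<in> Y"
    and bal: "\<And>v. (\<Sum>x | x \<in> X \<and> ?vt x = v. sg x * (1 - 3 * of_bool (x \<in> Y))) = 0"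
    using signed_third_balanced[OF finX pr cut sg div] by blast
  \<comment> \<open>\<open>Y\<close> is closed under \<open>pr\<close>, so it is a set of edge
    copies and descends to edges of \<open>G\<close>.\<close>
  define Z where "Z b = {e. \<exists>h\<in>halves G. edge_of G h = e \<and> (h, b) \<in> Y}" for b
  have Z: "edge_of G h \<in> Z b \<longleftrightarrow> (h, b) \<in> Y" if h: "h \<in> halves G" for h b
  proof
    assume "edge_of G h \<in> Z b"
    then obtain h' where h': "h' \<in> halves G" "edge_of G h' = edge_of G h" "(h', b) \<in> Y"
      by (auto simp: Z_def)
    show "(h, b) \<in> Y"
    proof (cases "h = h'")
      case False
      then have "h = opp h'" using opp_eqI h h' by auto
      then show ?thesis using Y(2)[OF h'(3)] by (simp add: pr_def)
    qed (use h' in auto)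
  qed (use h in \<open>auto simp: Z_def\<close>)
  \<comment> \<open>Off the support the opposite copies contribute the difference of their
    coefficients \<open>1 - 3 * of_bool ...\<close>; the ones cancel and 0 or 3 in absolute value
    remains.\<close>
  define f2 :: "'e \<Rightarrow> int" where "f2 e = (if f1 e = 0 then 3 * (of_bool (e \<in> Z False) - of_bool (e \<in> Z True))
    else r e * (1 - 3 * of_bool (e \<in> Z True)))" for e
  have "boundary G \<tau> f2 v = 0" for v
  proof -
    have "boundary G \<tau> f2 v = (\<Sum>x | x \<in> X \<and> ?vt x = v. sg x * (1 - 3 * of_bool (x \<in> Y)))"
      unfolding tsum boundary_def
    proof (intro sum.cong refl)
      fix h assume "h \<in> halves_at G v"
      then have "h \<in> halves G" by (simp add: halves_at_def)
      then show "f2 (edge_of G h) * \<tau> h = sg (h, True) * (1 - 3 * of_bool ((h, True) \<in> Y))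
          + (if ?Z h then sg (h, False) * (1 - 3 * of_bool ((h, False) \<in> Y)) else 0)"
        by (simp add: f2_def Z sg_def r_def algebra_simps)
    qed
    then show ?thesis using bal by simp
  qed
  moreover have "\<bar>f2 e\<bar> \<le> 3" for e using r[of e] by (auto simp: f2_def)
  ultimately have "integer_flow G \<tau> 4 f2" by (simp add: integer_flow_def)
  moreover have "f2 e \<in> {1, -1, 2, -2}" if "f1 e \<noteq> 0" for e using that r[of e] by (auto simp: f2_def)
  then have "supp G f1 \<subseteq> {e \<in> edges G. f2 e \<in> {1, -1, 2, -2}}" by (auto simp: supp_def)
  ultimately show ?thesis by blast
qed

end
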